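(* Let $k$ and $n$ be positive integers with $n\ge2$. Then \[\Phi_n^{(k)}(0)=\mathcal{B}_k\big(-r_1(n),\,-1!\,r_2(n),\,\dots,\,-(k-1)!\,r_k(n)\big).\]
   Context: $\Phi_n$ is the $n$-th cyclotomic polynomial. $r_j(n)=\sum_{1\le m\le n,\ \gcd(m,n)=1}\zeta_n^{mj}$ (Ramanujan sum), $\zeta_n=e^{2\pi i/n}$. The complete Bell polynomial is $\mathcal{B}_k(x_1,\dots,x_k)=\sum\frac{k!}{\lambda_1!\cdots\lambda_k!}\prod_{j=1}^k(x_j/j!)^{\lambda_j}$, summing over non-negative integer tuples $(\lambda_1,\dots,\lambda_k)$ with $\sum_j j\lambda_j=k$. *)

theory Defs
  imports Complex_Main "HOL-Library.FuncSet" "HOL-Computational_Algebra.Polynomial"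
begin

definition zeta :: "nat \<Rightarrow> complex" where
  "zeta n = exp (2 * complex_of_real pi * \<i> / of_nat n)"

text \<open>The product runs over all primitive \<open>n\<close>-th roots of unity, each occurring exactly once.
  The polynomial is taken over the complex numbers; its coefficients are in fact integers.\<close>

definition cyclotomic :: "nat \<Rightarrow> complex poly" where
  "cyclotomic n = (\<Prod>m | m \<in> {1..n} \<and> coprime m n. [:- (zeta n ^ m), 1:])"

definition ramanujan_sum :: "nat \<Rightarrow> nat \<Rightarrow> complex" where
  "ramanujan_sum j n = (\<Sum>m | m \<in> {1..n} \<and> coprime m n. zeta n ^ (m * j))"

text \<open>A tuple \<open>(\<lambda>\<^sub>1, \<dots>, \<lambda>\<^sub>k)\<close> is represented by an extensional function on \<open>{1..k}\<close>,
  so that distinct functions are distinct tuples.\<close>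

definition weight_tuples :: "nat \<Rightarrow> (nat \<Rightarrow> nat) set" where
  "weight_tuples k = {l \<in> {1..k} \<rightarrow>\<^sub>E UNIV. (\<Sum>j=1..k. j * l j) = k}"

lemma finite_weight_tuples: "finite (weight_tuples k)"
proof (rule finite_subset)
  show "weight_tuples k \<subseteq> ({1..k} \<rightarrow>\<^sub>E {0..k})"
  proof
    fix l assume l: "l \<in> weight_tuples k"
    have "l i \<le> k" if i: "i \<in> {1..k}" for i
    proof -
      have "l i \<le> i * l i" using i by simp
      also have "\<dots> \<le> (\<Sum>j=1..k. j * l j)"
        using i by (intro member_le_sum) auto
      also have "\<dots> = k" using l by (simp add: weight_tuples_def)
      finally show ?thesis .
    qed
    then show "l \<in> ({1..k} \<rightarrow>\<^sub>E {0..k})"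
      using l by (auto simp: weight_tuples_def PiE_iff)
  qed
  show "finite ({1..k} \<rightarrow>\<^sub>E {0..k})" by (intro finite_PiE) auto
qed

text \<open>Only the values \<open>x 1, \<dots>, x k\<close> of the argument sequence matter.\<close>

definition complete_bell :: "nat \<Rightarrow> (nat \<Rightarrow> 'a :: field_char_0) \<Rightarrow> 'a" where
  "complete_bell k x =
     (\<Sum>l\<in>weight_tuples k.
        fact k / (\<Prod>j=1..k. fact (l j)) * (\<Prod>j=1..k. (x j / fact j) ^ l j))"

end

theory Submission
  imports Defs "HOL-Computational_Algebra.Polynomial_FPS"
begin

text \<open>
  Pairing each primitive root with its inverse turns the defining product of \<open>\<Phi>\<^sub>n\<close> into
  \<open>\<Prod>(1 - \<zeta>\<^sup>m X)\<close>, whose logarithmic derivative is \<open>- \<Sum>\<^sub>j r\<^sub>j(n) X\<^bsup>j-1\<^esup>\<close>.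
  Hence the coefficients \<open>a\<^sub>k\<close> satisfy \<open>k a\<^sub>k = - \<Sum>\<^sub>j r\<^sub>j(n) a\<^bsub>k-j\<^esub>\<close>. The numbers
  \<open>B\<^sub>k / k!\<close> satisfy the same recurrence: weight each tuple by \<open>k = \<Sum>\<^sub>j j \<lambda>\<^sub>j\<close> and lower
  \<open>\<lambda>\<^sub>j\<close> by one in the \<open>j\<close>-th part.
\<close>

subsection \<open>Recurrence for complete Bell polynomials\<close>

text \<open>The number \<open>N\<close> of variables is decoupled from the weight \<open>k\<close>, so that the recurrence
  relates sums over tuples of the same length.\<close>

definition bell_tuples :: "nat \<Rightarrow> nat \<Rightarrow> (nat \<Rightarrow> nat) set" where
  "bell_tuples N k = {l \<in> {1..N} \<rightarrow>\<^sub>E UNIV. (\<Sum>j=1..N. j * l j) = k}"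

definition bell_weight :: "nat \<Rightarrow> (nat \<Rightarrow> 'a :: field_char_0) \<Rightarrow> (nat \<Rightarrow> nat) \<Rightarrow> 'a" where
  "bell_weight N p l = (\<Prod>j=1..N. p j ^ l j / fact (l j))"

text \<open>This is the coefficient of X^k in exp (p 1 X + ... + p N X^N). Since \<open>p j\<close>
  stands for x_j / j!, the outer factor k! is left out.\<close>

definition bell_coeff :: "nat \<Rightarrow> (nat \<Rightarrow> 'a :: field_char_0) \<Rightarrow> nat \<Rightarrow> 'a" where
  "bell_coeff N p k = (\<Sum>l\<in>bell_tuples N k. bell_weight N p l)"

lemma bell_tuples_mult_le:
  assumes "l \<in> bell_tuples N k" "i \<in> {1..N}"
  shows "i * l i \<le> k"
proof -
  have "i * l i \<le> (\<Sum>j=1..N. j * l j)"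
    using assms by (intro member_le_sum) auto
  then show ?thesis using assms by (simp add: bell_tuples_def)
qed

lemma finite_bell_tuples: "finite (bell_tuples N k)"
proof (rule finite_subset)
  show "bell_tuples N k \<subseteq> ({1..N} \<rightarrow>\<^sub>E {0..k})"
  proof
    fix l assume l: "l \<in> bell_tuples N k"
    have "l i \<le> k" if i: "i \<in> {1..N}" for i
    proof -
      have "l i \<le> i * l i" using i by simp
      also have "\<dots> \<le> k" by (rule bell_tuples_mult_le[OF l i])
      finally show ?thesis .
    qed
    then show "l \<in> ({1..N} \<rightarrow>\<^sub>E {0..k})"
      using l by (auto simp: bell_tuples_def PiE_iff)
  qed
  show "finite ({1..N} \<rightarrow>\<^sub>E {0..k})" by (intro finite_PiE) auto
qed

lemma complete_bell_eq_bell_coeff: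
  "complete_bell k x = fact k * bell_coeff k (\<lambda>j. x j / fact j) k"
  unfolding complete_bell_def bell_coeff_def bell_weight_def weight_tuples_def bell_tuples_def
    sum_distrib_left
  by (intro sum.cong refl) (simp add: prod_dividef)

lemma bell_coeff_0: "bell_coeff N p 0 = 1"
proof -
  have "bell_tuples N 0 = {\<lambda>j\<in>{1..N}. 0}"
    by (auto simp: bell_tuples_def PiE_iff extensional_def fun_eq_iff)
  then show ?thesis by (simp add: bell_coeff_def bell_weight_def)
qed

text \<open>Only the i-th factor changes, and it gains p i / (l i + 1). Clearing that denominator
  yields the factor \<open>l i\<close> that the recurrence puts on a tuple.\<close>

lemma bell_weight_increment:
  assumes "i \<in> {1..N}"
  shows "of_nat (Suc (l i)) * bell_weight N p (l(i := Suc (l i))) = p i * bell_weight N p l"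
proof -
  have "(\<Prod>j\<in>{1..N} - {i}. p j ^ (l(i := Suc (l i))) j / fact ((l(i := Suc (l i))) j)) =
        (\<Prod>j\<in>{1..N} - {i}. p j ^ l j / fact (l j))"
    by (intro prod.cong) auto
  then have "bell_weight N p (l(i := Suc (l i))) =
      p i ^ Suc (l i) / fact (Suc (l i)) * (\<Prod>j\<in>{1..N} - {i}. p j ^ l j / fact (l j))"
    using assms unfolding bell_weight_def by (subst prod.remove[of _ i]) auto
  moreover have "bell_weight N p l =
      p i ^ l i / fact (l i) * (\<Prod>j\<in>{1..N} - {i}. p j ^ l j / fact (l j))"
    using assms unfolding bell_weight_def by (subst prod.remove[of _ i]) auto
  moreover have "of_nat (Suc (l i)) * (p i ^ Suc (l i) / fact (Suc (l i))) =
      p i * (p i ^ l i / fact (l i))"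
    by (simp add: field_simps del: of_nat_Suc)
  ultimately show ?thesis by (simp only: mult.assoc[symmetric])
qed

lemma sum_increment:
  assumes "i \<in> {1..N::nat}"
  shows "(\<Sum>j=1..N. j * (l(i := Suc (l i))) j) = i + (\<Sum>j=1..N. j * l j)"
proof -
  have "(\<Sum>j=1..N. j * (l(i := Suc (l i))) j) = (\<Sum>j=1..N. (if j = i then i else 0) + j * l j)"
    by (intro sum.cong) auto
  then show ?thesis using assms by (simp add: sum.distrib)
qed

text \<open>Tuples with \<open>l i = 0\<close> contribute nothing. On the others, lowering
  \<open>l i\<close> by one is a bijection onto the tuples of weight \<open>k - i\<close>, and the
  factor \<open>l i\<close> cancels against \<open>fact (l i)\<close>.\<close>

lemma bell_coeff_part:
  assumes i: "i \<in> {1..N}" and "i \<le> k"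
  shows "(\<Sum>l\<in>bell_tuples N k. of_nat (l i) * bell_weight N p l) = p i * bell_coeff N p (k - i)"
proof -
  let ?up = "\<lambda>l :: nat \<Rightarrow> nat. l(i := Suc (l i))"
  have "(\<Sum>l\<in>bell_tuples N k. of_nat (l i) * bell_weight N p l) =
        (\<Sum>l\<in>{l\<in>bell_tuples N k. l i > 0}. of_nat (l i) * bell_weight N p l)"
    by (intro sum.mono_neutral_right) (auto simp: finite_bell_tuples)
  also have "\<dots> = (\<Sum>l\<in>bell_tuples N (k - i). of_nat (?up l i) * bell_weight N p (?up l))"
  proof (rule sum.reindex_bij_witness[of _ ?up "\<lambda>l. l(i := l i - 1)"])
    fix l assume "l \<in> {l\<in>bell_tuples N k. l i > 0}"
    then have l: "l \<in> bell_tuples N k" "l i > 0" by auto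
    \<comment> \<open>Positivity of \<open>l i\<close> is what makes the truncated subtraction
      reversible.\<close>
    show up: "?up (l(i := l i - 1)) = l" using l by auto
    show "l(i := l i - 1) \<in> bell_tuples N (k - i)"
      using l i sum_increment[OF i, of "l(i := l i - 1)"] unfolding up
      by (auto simp: bell_tuples_def PiE_iff extensional_def)
    show "of_nat (?up (l(i := l i - 1)) i) * bell_weight N p (?up (l(i := l i - 1))) =
        of_nat (l i) * bell_weight N p l"
      unfolding up ..
  next
    fix l assume l: "l \<in> bell_tuples N (k - i)"
    show "(?up l)(i := ?up l i - 1) = l" by auto
    show "?up l \<in> {l\<in>bell_tuples N k. l i > 0}"
      using l assms sum_increment[OF i, of l]
      by (auto simp: bell_tuples_def PiE_iff extensional_def)
  qed
  also have "\<dots> = p i * bell_coeff N p (k - i)"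
    using bell_weight_increment[OF i, of _ p]
    by (simp add: bell_coeff_def sum_distrib_left del: of_nat_Suc)
  finally show ?thesis .
qed

text \<open>Coefficientwise, this is F' = G' F for F = exp G. Keeping \<open>N\<close> fixed on both
  sides allows induction on \<open>k\<close>.\<close>

lemma bell_coeff_recurrence:
  assumes "k \<le> N"
  shows "of_nat k * bell_coeff N p k = (\<Sum>j=1..k. of_nat j * p j * bell_coeff N p (k - j))"
proof -
  have "of_nat k * bell_coeff N p k =
      (\<Sum>l\<in>bell_tuples N k. \<Sum>j=1..N. of_nat j * (of_nat (l j) * bell_weight N p l))"
    unfolding bell_coeff_def sum_distrib_left
  proof (rule sum.cong[OF refl])
    fix l assume "l \<in> bell_tuples N k"
    then have "of_nat k = (\<Sum>j=1..N. of_nat j * of_nat (l j) :: 'a)"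
      unfolding bell_tuples_def by (auto simp flip: of_nat_mult of_nat_sum)
    then show "of_nat k * bell_weight N p l =
        (\<Sum>j=1..N. of_nat j * (of_nat (l j) * bell_weight N p l))"
      by (simp add: sum_distrib_right mult.assoc)
  qed
  also have "\<dots> = (\<Sum>j=1..N. \<Sum>l\<in>bell_tuples N k. of_nat j * (of_nat (l j) * bell_weight N p l))"
    by (rule sum.swap)
  \<comment> \<open>A part j > k would exceed the total weight, so its multiplicity is 0.\<close>
  also have "\<dots> = (\<Sum>j=1..k. \<Sum>l\<in>bell_tuples N k. of_nat j * (of_nat (l j) * bell_weight N p l))"
  proof (rule sum.mono_neutral_right)
    show "\<forall>j\<in>{1..N} - {1..k}.
        (\<Sum>l\<in>bell_tuples N k. of_nat j * (of_nat (l j) * bell_weight N p l)) = 0"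
    proof (intro ballI sum.neutral)
      fix j l assume j: "j \<in> {1..N} - {1..k}" and l: "l \<in> bell_tuples N k"
      then have "j * l j \<le> k" using bell_tuples_mult_le[OF l] by auto
      with j have "l j = 0" by (cases "l j") auto
      then show "of_nat j * (of_nat (l j) * bell_weight N p l) = 0" by simp
    qed
  qed (use assms in auto)
  also have "\<dots> = (\<Sum>j=1..k. of_nat j * p j * bell_coeff N p (k - j))"
  proof (rule sum.cong[OF refl])
    fix j assume "j \<in> {1..k}"
    then have "(\<Sum>l\<in>bell_tuples N k. of_nat (l j) * bell_weight N p l) = p j * bell_coeff N p (k - j)"
      using assms by (intro bell_coeff_part) auto
    then show "(\<Sum>l\<in>bell_tuples N k. of_nat j * (of_nat (l j) * bell_weight N p l)) =
        of_nat j * p j * bell_coeff N p (k - j)"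
      by (simp add: sum_distrib_left[symmetric] mult.assoc)
  qed
  finally show ?thesis .
qed

text \<open>The recurrence determines each \<open>a m\<close> from earlier values, as m is
  invertible in characteristic 0. The coefficient has \<open>fact (j - 1)\<close> because j x_j / j!
  = x_j / (j-1)!.\<close>

lemma complete_bell_unique:
  fixes a x :: "nat \<Rightarrow> 'a :: field_char_0"
  assumes "a 0 = 1"
    and rec: "\<And>m. m \<ge> 1 \<Longrightarrow> of_nat m * a m = (\<Sum>j=1..m. x j / fact (j - 1) * a (m - j))"
  shows "complete_bell k x = fact k * a k"
proof -
  let ?b = "bell_coeff k (\<lambda>j. x j / fact j)"
  have "?b m = a m" if "m \<le> k" for m
    using that
  proof (induction m rule: less_induct)
    case (less m)
    show ?case
    proof (cases "m = 0")
      case True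
      then show ?thesis using assms(1) by (simp add: bell_coeff_0)
    next
      case False
      have "of_nat m * ?b m = (\<Sum>j=1..m. of_nat j * (x j / fact j) * ?b (m - j))"
        using less.prems by (rule bell_coeff_recurrence)
      also have "\<dots> = (\<Sum>j=1..m. x j / fact (j - 1) * a (m - j))"
      proof (rule sum.cong[OF refl])
        fix j assume j: "j \<in> {1..m}"
        then have "of_nat j * (x j / fact j) = x j / fact (j - 1)"
          by (subst fact_reduce[of j]) auto
        moreover have "?b (m - j) = a (m - j)" using j less by simp
        ultimately show "of_nat j * (x j / fact j) * ?b (m - j) = x j / fact (j - 1) * a (m - j)"
          by simp
      qed
      also have "\<dots> = of_nat m * a m" using False by (simp add: rec)
      finally show ?thesis using False by simp
    qed
  qed
  then show ?thesis by (simp add: complete_bell_eq_bell_coeff)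
qed

subsection \<open>Newton's identities\<close>

text \<open>The logarithmic derivative of 1 - b X is -b / (1 - b X), a geometric series; adding
  these over the factors gives power sums. Multiplying out the denominators keeps the identity valid
  in any commutative ring.\<close>

lemma fps_deriv_prod_linear:
  fixes f :: "'b \<Rightarrow> 'a :: comm_ring_1"
  assumes "finite A"
  shows "fps_deriv (\<Prod>i\<in>A. 1 - fps_const (f i) * fps_X) =
    - (Abs_fps (\<lambda>j. \<Sum>i\<in>A. f i ^ Suc j) * (\<Prod>i\<in>A. 1 - fps_const (f i) * fps_X))"
  using assms
proof (induction A rule: finite_induct)
  case empty
  show ?case by (simp add: fps_eq_iff fps_mult_nth)
next
  case (insert b A)
  let ?L = "1 - fps_const (f b) * fps_X" and ?P = "\<Prod>i\<in>A. 1 - fps_const (f i) * fps_X"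
  let ?S = "Abs_fps (\<lambda>j. \<Sum>i\<in>A. f i ^ Suc j)" and ?T = "Abs_fps (\<lambda>j. f b ^ Suc j)"
  \<comment> \<open>The geometric series for b / (1 - b X), with b = \<open>f b\<close>, telescopes
    against its denominator.\<close>
  have TL: "?T * ?L = fps_const (f b)"
  proof (rule fps_ext)
    fix m
    have "?T * ?L = ?T - fps_const (f b) * (?T * fps_X)" by (simp add: algebra_simps)
    then show "fps_nth (?T * ?L) m = fps_nth (fps_const (f b)) m"
      by (cases m) auto
  qed
  have ST: "Abs_fps (\<lambda>j. \<Sum>i\<in>insert b A. f i ^ Suc j) = ?T + ?S"
    using insert.hyps by (simp add: fps_eq_iff)
  have distrib: "L * - (S * P) - T * L * P = - ((T + S) * (L * P))" for L P S T :: "'a fps"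
    by (simp add: algebra_simps)
  have "fps_deriv (?L * ?P) = ?L * fps_deriv ?P - fps_const (f b) * ?P"
    by (simp flip: fps_const_neg)
  also have "\<dots> = ?L * - (?S * ?P) - ?T * ?L * ?P"
    by (simp only: insert.IH TL)
  also have "\<dots> = - ((?T + ?S) * (?L * ?P))"
    by (rule distrib)
  finally show ?case unfolding ST using insert.hyps by simp
qed

text \<open>Compare coefficients of X^(m-1) in the derivative identity. No upper bound on
  \<open>m\<close> is required: coefficients beyond the degree are 0.\<close>

lemma coeff_prod_linear_recurrence:
  fixes f :: "'b \<Rightarrow> 'a :: comm_ring_1"
  assumes "finite A" "m \<ge> 1"
  defines "P \<equiv> \<Prod>i\<in>A. [:1, - f i:]"
  shows "of_nat m * coeff P m = (\<Sum>j=1..m. - (\<Sum>i\<in>A. f i ^ j) * coeff P (m - j))"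
proof -
  have P: "fps_of_poly P = (\<Prod>i\<in>A. 1 - fps_const (f i) * fps_X)"
    by (simp add: P_def fps_of_poly_prod fps_of_poly_pCons flip: fps_const_neg)
  obtain m' where m: "m = Suc m'" using assms(2) by (cases m) auto
  have deriv: "fps_deriv (fps_of_poly P) = - (Abs_fps (\<lambda>j. \<Sum>i\<in>A. f i ^ Suc j) * fps_of_poly P)"
    unfolding P by (rule fps_deriv_prod_linear[OF assms(1)])
  have "of_nat m * coeff P m = fps_nth (fps_deriv (fps_of_poly P)) m'"
    by (simp add: m)
  also have "\<dots> = - (\<Sum>j=0..m'. (\<Sum>i\<in>A. f i ^ Suc j) * coeff P (m' - j))"
    unfolding deriv by (simp add: fps_mult_nth)
  also have "\<dots> = - (\<Sum>j=1..m. (\<Sum>i\<in>A. f i ^ j) * coeff P (m - j))"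
    unfolding m One_nat_def sum.shift_bounds_cl_Suc_ivl by simp
  finally show ?thesis by (simp add: sum_negf)
qed

subsection \<open>The cyclotomic polynomial\<close>

lemma zeta_power_pair:
  assumes "n \<ge> 1" "m \<le> n"
  shows "zeta n ^ m * zeta n ^ (n - m) = 1"
proof -
  have "zeta n ^ n = exp (of_nat n * (2 * complex_of_real pi * \<i> / of_nat n))"
    by (simp only: zeta_def exp_of_nat_mult)
  also have "\<dots> = exp (2 * of_real pi * \<i>)" using assms by simp
  also have "\<dots> = 1" by (rule exp_two_pi_i)
  finally show ?thesis using assms by (simp flip: power_add)
qed

text \<open>These facts make m -> n - m an involution of the index set. For n = 1 it would send the
  index 1 to 0, outside the range.\<close>

lemma coprime_complement:
  fixes m n :: nat
  assumes "n \<ge> 2" "m \<in> {1..n}" "coprime m n"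
  shows "m < n" "n - m \<in> {1..n}" "coprime (n - m) n"
proof -
  have "m \<noteq> n" using assms by auto
  then show "m < n" using assms by simp
  then show "n - m \<in> {1..n}" using assms by simp
  show "coprime (n - m) n"
    using assms by (metis atLeastAtMost_iff coprime_iff_gcd_eq_1 gcd_diff2_nat gcd.commute)
qed

text \<open>This is the constant term of the cyclotomic polynomial. The factors for m and n - m
  multiply to 1; n = 2 is separate because m = 1 is then its own partner, with factor -(-1) =
  1.\<close>

lemma prod_minus_primitive_roots:
  assumes "n \<ge> 2"
  shows "(\<Prod>m | m \<in> {1..n} \<and> coprime m n. - (zeta n ^ m)) = 1"
proof (cases "n = 2")
  case True
  then have "{m. m \<in> {1..n} \<and> coprime m n} = {1}"
    using coprime_complement(1)[OF assms] by force
  moreover have "zeta 2 = -1" by (simp add: zeta_def exp_pi_i)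
  ultimately show ?thesis using True by simp
next
  case False
  with assms have n: "n > 2" by simp
  let ?L = "{m \<in> {1..n}. coprime m n \<and> 2 * m < n}"
  let ?U = "{m \<in> {1..n}. coprime m n \<and> n < 2 * m}"
  have "{m. m \<in> {1..n} \<and> coprime m n} = ?L \<union> ?U"
  proof -
    \<comment> \<open>A self-paired index would divide n while being coprime to it, forcing m = 1
      and n = 2.\<close>
    have "2 * m \<noteq> n" if "coprime m n" for m
    proof
      assume eq: "2 * m = n"
      then have "m dvd n" by auto
      with that have "m = 1" by (simp add: coprime_absorb_left)
      with eq n show False by simp
    qed
    then show ?thesis by (force simp: neq_iff)
  qed
  then have "(\<Prod>m | m \<in> {1..n} \<and> coprime m n. - (zeta n ^ m)) =
      (\<Prod>m\<in>?L. - (zeta n ^ m)) * (\<Prod>m\<in>?U. - (zeta n ^ m))"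
    by (simp only:) (intro prod.union_disjoint, auto)
  also have "(\<Prod>m\<in>?U. - (zeta n ^ m)) = (\<Prod>m\<in>?L. - (zeta n ^ (n - m)))"
    by (rule prod.reindex_bij_witness[of _ "\<lambda>m. n - m" "\<lambda>m. n - m"])
      (use coprime_complement[OF assms] in auto)
  also have "(\<Prod>m\<in>?L. - (zeta n ^ m)) * (\<Prod>m\<in>?L. - (zeta n ^ (n - m))) = (\<Prod>m\<in>?L. 1)"
    unfolding prod.distrib[symmetric] using zeta_power_pair by (intro prod.cong) auto
  finally show ?thesis by simp
qed

text \<open>Factor X - z as -z (1 - X / z), where 1 / z is the root with exponent n - m. The scalars
  multiply to 1, and inversion permutes the primitive roots.\<close>

lemma cyclotomic_eq_prod_reversed:
  assumes "n \<ge> 2"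
  shows "cyclotomic n = (\<Prod>m | m \<in> {1..n} \<and> coprime m n. [:1, - (zeta n ^ m):])"
proof -
  let ?S = "{m. m \<in> {1..n} \<and> coprime m n}"
  have "cyclotomic n = (\<Prod>m\<in>?S. smult (- (zeta n ^ m)) [:1, - (zeta n ^ (n - m)):])"
    unfolding cyclotomic_def using zeta_power_pair by (intro prod.cong) auto
  also have "\<dots> = (\<Prod>m\<in>?S. [:1, - (zeta n ^ (n - m)):])"
    by (simp only: prod_smult prod_minus_primitive_roots[OF assms] smult_1_left)
  also have "\<dots> = (\<Prod>m\<in>?S. [:1, - (zeta n ^ m):])"
    by (rule prod.reindex_bij_witness[of _ "\<lambda>m. n - m" "\<lambda>m. n - m"])
      (use coprime_complement[OF assms] in auto)
  finally show ?thesis .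
qed

theorem theorem4p2:
  fixes k n :: nat
  assumes "k \<ge> 1" and "n \<ge> 2"
  shows "poly ((pderiv ^^ k) (cyclotomic n)) 0 =
           complete_bell k (\<lambda>j. - (fact (j - 1) * ramanujan_sum j n))"
proof -
  have "complete_bell k (\<lambda>j. - (fact (j - 1) * ramanujan_sum j n)) =
      fact k * coeff (cyclotomic n) k"
  proof (rule complete_bell_unique)
    show "coeff (cyclotomic n) 0 = 1"
      by (simp add: cyclotomic_eq_prod_reversed[OF assms(2)] flip: poly_0_coeff_0)
        (simp add: poly_prod)
    fix m :: nat assume "m \<ge> 1"
    then show "of_nat m * coeff (cyclotomic n) m =
        (\<Sum>j=1..m. - (fact (j - 1) * ramanujan_sum j n) / fact (j - 1) * coeff (cyclotomic n) (m - j))"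
      unfolding cyclotomic_eq_prod_reversed[OF assms(2)]
      \<comment> \<open>The Ramanujan sum is the j-th power sum of the primitive roots, and the two
        factorials cancel.\<close>
      by (subst coeff_prod_linear_recurrence) (auto simp: ramanujan_sum_def power_mult)
  qed
  also have "\<dots> = poly ((pderiv ^^ k) (cyclotomic n)) 0"
    by (simp add: poly_0_coeff_0 coeff_higher_pderiv pochhammer_fact)
  finally show ?thesis by simp
qed

end
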